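(* Let $M$ be a monoid, let $X$ be a set, and let $R$ be a set of admissible identities over $X^*$. Then $M$ is left cancellative (resp. right cancellative, cancellative) if and only if the restriction monoid $\mathcal{FR}_R(M)$ is right ample (resp. left ample, ample).
   Context: Restriction monoids. A restriction semigroup is an algebra $(S;\cdot,{}^*,{}^+)$ with $(S;\cdot)$ a semigroup satisfying $x^+x=x$, $x^+y^+=y^+x^+$, $(x^+y)^+=x^+y^+$, $xy^+=(xy)^+x$; $xx^*=x$, $x^*y^*=y^*x^*$, $(xy^* )^*=x^*y^*$, $x^*y=y(xy)^*$; $(x^+)^*=x^+$, $(x^* )^+=x^*$. A restriction monoid is a restriction semigroup with an identity element, in signature $(\cdot,{}^*,{}^+,1)$; morphisms preserve all operations. $P(S)=\{s^*:s\in S\}=\{s^+:s\in S\}$. Left cancellative: $us=ut\Rightarrow s=t$; right cancellative: $su=tu\Rightarrow s=t$; cancellative: both. A restriction semigroup $S$ is left ample if for all $s,t,u\in S$: $su=tu\Rightarrow su^+=tu^+$; right ample if for all $s,t,u$: $us=ut\Rightarrow u^*s=u^*t$; ample if both. Identities. $X^*$ is the free monoid on a set $X$ (empty word $\lambda$), and $FR(X^* )$ is the free restriction monoid on the set $X^*$ (its product is written $\cdot$, its identity is $1\neq\lambda$; the generator $uv$ is different from the product $u\cdot v$). For a map $f\colon X\to M$ into a monoid, with monoid-morphism extension $\widehat f\colon X^*\to M$, and a map $\gamma\colon M\to S$ into a restriction monoid, the value $[p]_{\gamma,f}\in S$ of $p\in FR(X^* )$ is the image of $p$ under the morphism $FR(X^*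 )\to S$ sending each generator $u\in X^*$ to $\gamma(\widehat f(u))$. An identity over $X^*$ is an equality $p=q$ with $p,q\in FR(X^* )$; $\gamma$ satisfies it if $[p]_{\gamma,f}=[q]_{\gamma,f}$ for all $f\colon X\to M$. An identity is admissible if every monoid morphism from a monoid to a restriction monoid (i.e. map preserving $1$ and products) satisfies it. $\mathcal{FR}_R(M)$ is the restriction monoid generated by the set $\{\lfloor m\rfloor:m\in M\}$ subject to the relations $\lfloor 1\rfloor=1$, $\lfloor m\rfloor\lfloor n\rfloor=\lfloor mn\rfloor(\lfloor m\rfloor\lfloor n\rfloor)^*$ ($m,n\in M$), and $[p]_{\iota,f}=[q]_{\iota,f}$ for all identities $p=q$ in $R$ and all $f\colon X\to M$, where $\iota(m)=\lfloor m\rfloor$. *)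

theory Defs
  imports "HOL-Algebra.Group"
begin

unbundle no rtrancl_syntax and no trancl_syntax

section \<open>Monoids\<close>

definition left_cancellative :: "('m, 'z) monoid_scheme \<Rightarrow> bool" where
  "left_cancellative M \<longleftrightarrow>
    (\<forall>u\<in>carrier M. \<forall>s\<in>carrier M. \<forall>t\<in>carrier M. u \<otimes>\<^bsub>M\<^esub> s = u \<otimes>\<^bsub>M\<^esub> t \<longrightarrow> s = t)"

definition right_cancellative :: "('m, 'z) monoid_scheme \<Rightarrow> bool" where
  "right_cancellative M \<longleftrightarrow>
    (\<forall>u\<in>carrier M. \<forall>s\<in>carrier M. \<forall>t\<in>carrier M. s \<otimes>\<^bsub>M\<^esub> u = t \<otimes>\<^bsub>M\<^esub> u \<longrightarrow> s = t)"

definition cancellative :: "('m, 'z) monoid_scheme \<Rightarrow> bool" where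
  "cancellative M \<longleftrightarrow> left_cancellative M \<and> right_cancellative M"

text \<open>Unlike \<^const>\<open>hom\<close>, monoid morphisms preserve the identity.\<close>

definition monoid_mor :: "('m, 'y) monoid_scheme \<Rightarrow> ('s, 'z) monoid_scheme \<Rightarrow> ('m \<Rightarrow> 's) set" where
  "monoid_mor M S = {h \<in> hom M S. h \<one>\<^bsub>M\<^esub> = \<one>\<^bsub>S\<^esub>}"

text \<open>The free monoid on \<open>X\<close> has carrier \<open>lists X\<close>; this is the extension to it of
  \<open>f \<in> X \<rightarrow> carrier M\<close>.\<close>

definition word_ext :: "('m, 'z) monoid_scheme \<Rightarrow> ('x \<Rightarrow> 'm) \<Rightarrow> 'x list \<Rightarrow> 'm" where
  "word_ext M f w = foldr (\<lambda>x m. f x \<otimes>\<^bsub>M\<^esub> m) w \<one>\<^bsub>M\<^esub>"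


section \<open>Restriction monoids\<close>

record 'a restr_monoid = "'a monoid" +
  rstar :: "'a \<Rightarrow> 'a"  (\<open>(_\<^sup>*\<index>)\<close> [1000] 999)
  rplus :: "'a \<Rightarrow> 'a"  (\<open>(_\<^sup>+\<index>)\<close> [1000] 999)

locale restriction_monoid = monoid S for S (structure) +
  assumes star_closed [simp, intro]: "x \<in> carrier S \<Longrightarrow> x\<^sup>* \<in> carrier S"
    and plus_closed [simp, intro]: "x \<in> carrier S \<Longrightarrow> x\<^sup>+ \<in> carrier S"
    and plus_mult: "x \<in> carrier S \<Longrightarrow> x\<^sup>+ \<otimes> x = x"
    and plus_commute: "\<lbrakk>x \<in> carrier S; y \<in> carrier S\<rbrakk> \<Longrightarrow> x\<^sup>+ \<otimes> y\<^sup>+ = y\<^sup>+ \<otimes> x\<^sup>+"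
    and plus_plus_mult: "\<lbrakk>x \<in> carrier S; y \<in> carrier S\<rbrakk> \<Longrightarrow> (x\<^sup>+ \<otimes> y)\<^sup>+ = x\<^sup>+ \<otimes> y\<^sup>+"
    and mult_plus: "\<lbrakk>x \<in> carrier S; y \<in> carrier S\<rbrakk> \<Longrightarrow> x \<otimes> y\<^sup>+ = (x \<otimes> y)\<^sup>+ \<otimes> x"
    and mult_star: "x \<in> carrier S \<Longrightarrow> x \<otimes> x\<^sup>* = x"
    and star_commute: "\<lbrakk>x \<in> carrier S; y \<in> carrier S\<rbrakk> \<Longrightarrow> x\<^sup>* \<otimes> y\<^sup>* = y\<^sup>* \<otimes> x\<^sup>*"
    and star_mult_star: "\<lbrakk>x \<in> carrier S; y \<in> carrier S\<rbrakk> \<Longrightarrow> (x \<otimes> y\<^sup>*)\<^sup>* = x\<^sup>* \<otimes> y\<^sup>*"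
    and star_mult: "\<lbrakk>x \<in> carrier S; y \<in> carrier S\<rbrakk> \<Longrightarrow> x\<^sup>* \<otimes> y = y \<otimes> (x \<otimes> y)\<^sup>*"
    and star_plus: "x \<in> carrier S \<Longrightarrow> (x\<^sup>+)\<^sup>* = x\<^sup>+"
    and plus_star: "x \<in> carrier S \<Longrightarrow> (x\<^sup>*)\<^sup>+ = x\<^sup>*"

definition restriction_mor ::
    "('s, 'y) restr_monoid_scheme \<Rightarrow> ('t, 'z) restr_monoid_scheme \<Rightarrow> ('s \<Rightarrow> 't) set" where
  "restriction_mor S T = {h \<in> monoid_mor S T.
     \<forall>x\<in>carrier S. h (x\<^sup>*\<^bsub>S\<^esub>) = (h x)\<^sup>*\<^bsub>T\<^esub> \<and> h (x\<^sup>+\<^bsub>S\<^esub>) = (h x)\<^sup>+\<^bsub>T\<^esub>}"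

definition left_ample :: "('s, 'z) restr_monoid_scheme \<Rightarrow> bool" where
  "left_ample S \<longleftrightarrow> (\<forall>s\<in>carrier S. \<forall>t\<in>carrier S. \<forall>u\<in>carrier S.
     s \<otimes>\<^bsub>S\<^esub> u = t \<otimes>\<^bsub>S\<^esub> u \<longrightarrow> s \<otimes>\<^bsub>S\<^esub> u\<^sup>+\<^bsub>S\<^esub> = t \<otimes>\<^bsub>S\<^esub> u\<^sup>+\<^bsub>S\<^esub>)"

definition right_ample :: "('s, 'z) restr_monoid_scheme \<Rightarrow> bool" where
  "right_ample S \<longleftrightarrow> (\<forall>s\<in>carrier S. \<forall>t\<in>carrier S. \<forall>u\<in>carrier S.
     u \<otimes>\<^bsub>S\<^esub> s = u \<otimes>\<^bsub>S\<^esub> t \<longrightarrow> u\<^sup>*\<^bsub>S\<^esub> \<otimes>\<^bsub>S\<^esub> s = u\<^sup>*\<^bsub>S\<^esub> \<otimes>\<^bsub>S\<^esub> t)"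

definition ample :: "('s, 'z) restr_monoid_scheme \<Rightarrow> bool" where
  "ample S \<longleftrightarrow> left_ample S \<and> right_ample S"


section \<open>Free and presented restriction monoids\<close>

datatype 'a rterm = Gen 'a | One | Mul "'a rterm" "'a rterm" | Star "'a rterm" | Plus "'a rterm"

definition rterms :: "'a set \<Rightarrow> 'a rterm set" where
  "rterms A = {t. set_rterm t \<subseteq> A}"

primrec eval :: "('s, 'z) restr_monoid_scheme \<Rightarrow> ('a \<Rightarrow> 's) \<Rightarrow> 'a rterm \<Rightarrow> 's" where
  "eval S g (Gen a) = g a"
| "eval S g One = \<one>\<^bsub>S\<^esub>"
| "eval S g (Mul s t) = eval S g s \<otimes>\<^bsub>S\<^esub> eval S g t"
| "eval S g (Star t) = (eval S g t)\<^sup>*\<^bsub>S\<^esub>"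
| "eval S g (Plus t) = (eval S g t)\<^sup>+\<^bsub>S\<^esub>"

text \<open>The least congruence on the terms over \<open>A\<close> that contains \<open>\<rho>\<close> and whose
  quotient is a restriction monoid.\<close>

inductive_set rcong :: "'a set \<Rightarrow> ('a rterm \<times> 'a rterm) set \<Rightarrow> ('a rterm \<times> 'a rterm) set"
  for A :: "'a set" and \<rho> :: "('a rterm \<times> 'a rterm) set" where
  rel: "\<lbrakk>(s, t) \<in> \<rho>; s \<in> rterms A; t \<in> rterms A\<rbrakk> \<Longrightarrow> (s, t) \<in> rcong A \<rho>"
| refl: "s \<in> rterms A \<Longrightarrow> (s, s) \<in> rcong A \<rho>"
| sym: "(s, t) \<in> rcong A \<rho> \<Longrightarrow> (t, s) \<in> rcong A \<rho>"
| trans: "\<lbrakk>(s, t) \<in> rcong A \<rho>; (t, u) \<in> rcong A \<rho>\<rbrakk> \<Longrightarrow> (s, u) \<in> rcong A \<rho>"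
| Mul: "\<lbrakk>(s, s') \<in> rcong A \<rho>; (t, t') \<in> rcong A \<rho>\<rbrakk> \<Longrightarrow> (Mul s t, Mul s' t') \<in> rcong A \<rho>"
| Star: "(s, s') \<in> rcong A \<rho> \<Longrightarrow> (Star s, Star s') \<in> rcong A \<rho>"
| Plus: "(s, s') \<in> rcong A \<rho> \<Longrightarrow> (Plus s, Plus s') \<in> rcong A \<rho>"
| assoc: "\<lbrakk>x \<in> rterms A; y \<in> rterms A; z \<in> rterms A\<rbrakk> \<Longrightarrow>
    (Mul (Mul x y) z, Mul x (Mul y z)) \<in> rcong A \<rho>"
| l_one: "x \<in> rterms A \<Longrightarrow> (Mul One x, x) \<in> rcong A \<rho>"
| r_one: "x \<in> rterms A \<Longrightarrow> (Mul x One, x) \<in> rcong A \<rho>"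
| plus_mult: "x \<in> rterms A \<Longrightarrow> (Mul (Plus x) x, x) \<in> rcong A \<rho>"
| plus_commute: "\<lbrakk>x \<in> rterms A; y \<in> rterms A\<rbrakk> \<Longrightarrow>
    (Mul (Plus x) (Plus y), Mul (Plus y) (Plus x)) \<in> rcong A \<rho>"
| plus_plus_mult: "\<lbrakk>x \<in> rterms A; y \<in> rterms A\<rbrakk> \<Longrightarrow>
    (Plus (Mul (Plus x) y), Mul (Plus x) (Plus y)) \<in> rcong A \<rho>"
| mult_plus: "\<lbrakk>x \<in> rterms A; y \<in> rterms A\<rbrakk> \<Longrightarrow>
    (Mul x (Plus y), Mul (Plus (Mul x y)) x) \<in> rcong A \<rho>"
| mult_star: "x \<in> rterms A \<Longrightarrow> (Mul x (Star x), x) \<in> rcong A \<rho>"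
| star_commute: "\<lbrakk>x \<in> rterms A; y \<in> rterms A\<rbrakk> \<Longrightarrow>
    (Mul (Star x) (Star y), Mul (Star y) (Star x)) \<in> rcong A \<rho>"
| star_mult_star: "\<lbrakk>x \<in> rterms A; y \<in> rterms A\<rbrakk> \<Longrightarrow>
    (Star (Mul x (Star y)), Mul (Star x) (Star y)) \<in> rcong A \<rho>"
| star_mult: "\<lbrakk>x \<in> rterms A; y \<in> rterms A\<rbrakk> \<Longrightarrow>
    (Mul (Star x) y, Mul y (Star (Mul x y))) \<in> rcong A \<rho>"
| star_plus: "x \<in> rterms A \<Longrightarrow> (Star (Plus x), Plus x) \<in> rcong A \<rho>"
| plus_star: "x \<in> rterms A \<Longrightarrow> (Plus (Star x), Star x) \<in> rcong A \<rho>"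

definition term_quot ::
    "'a set \<Rightarrow> ('a rterm \<times> 'a rterm) set \<Rightarrow> 'a rterm set restr_monoid" where
  "term_quot A \<theta> =
    \<lparr>carrier = rterms A // \<theta>,
     monoid.mult = (\<lambda>P Q. \<Union>s\<in>P. \<Union>t\<in>Q. \<theta> `` {Mul s t}),
     one = \<theta> `` {One},
     rstar = (\<lambda>P. \<Union>s\<in>P. \<theta> `` {Star s}),
     rplus = (\<lambda>P. \<Union>s\<in>P. \<theta> `` {Plus s})\<rparr>"

definition FR :: "'a set \<Rightarrow> 'a rterm set restr_monoid" where
  "FR A = term_quot A (rcong A {})"

definition FR_class :: "'a set \<Rightarrow> 'a rterm \<Rightarrow> 'a rterm set" where
  "FR_class A t = rcong A {} `` {t}"

definition FR_gen :: "'a set \<Rightarrow> 'a \<Rightarrow> 'a rterm set" where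
  "FR_gen A a = FR_class A (Gen a)"

text \<open>For \<open>g \<in> A \<rightarrow> carrier S\<close>, the morphism \<open>FR A \<rightarrow> S\<close> that extends \<open>g\<close>;
  see \<open>FR_lift_mor\<close>, \<open>FR_lift_gen\<close> and \<open>FR_lift_unique\<close> below.\<close>

definition FR_lift :: "('s, 'z) restr_monoid_scheme \<Rightarrow> ('a \<Rightarrow> 's) \<Rightarrow> 'a rterm set \<Rightarrow> 's" where
  "FR_lift S g p = the_elem (eval S g ` p)"

text \<open>The restriction monoid generated by \<open>A\<close> subject to relations
  \<open>rels \<subseteq> carrier (FR A) \<times> carrier (FR A)\<close>.\<close>

definition FR_presented ::
    "'a set \<Rightarrow> ('a rterm set \<times> 'a rterm set) set \<Rightarrow> 'a rterm set restr_monoid" where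
  "FR_presented A rels = term_quot A (rcong A {(s, t). (FR_class A s, FR_class A t) \<in> rels})"


section \<open>Identities over a free monoid\<close>

definition identities :: "'x set \<Rightarrow> ('x list rterm set \<times> 'x list rterm set) set" where
  "identities X = carrier (FR (lists X)) \<times> carrier (FR (lists X))"

definition identity_value ::
    "('m, 'y) monoid_scheme \<Rightarrow> ('s, 'z) restr_monoid_scheme \<Rightarrow> ('m \<Rightarrow> 's) \<Rightarrow> ('x \<Rightarrow> 'm)
      \<Rightarrow> 'x list rterm set \<Rightarrow> 's" where
  "identity_value M S \<gamma> f p = FR_lift S (\<lambda>u. \<gamma> (word_ext M f u)) p"

definition satisfies_identity ::
    "'x set \<Rightarrow> ('m, 'y) monoid_scheme \<Rightarrow> ('s, 'z) restr_monoid_scheme \<Rightarrow> ('m \<Rightarrow> 's)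
      \<Rightarrow> 'x list rterm set \<times> 'x list rterm set \<Rightarrow> bool" where
  "satisfies_identity X M S \<gamma> e \<longleftrightarrow>
    (\<forall>f \<in> X \<rightarrow> carrier M. identity_value M S \<gamma> f (fst e) = identity_value M S \<gamma> f (snd e))"

text \<open>A formula cannot quantify over types, so the monoids \<open>M\<close> range over all monoids
  with carrier in \<open>'x list\<close> and the restriction monoids \<open>S\<close> over all those with carrier in
  \<open>'x list rterm set\<close>. This loses nothing: \<open>admissible_all_types\<close> below shows that for an
  admissible identity the same holds for monoids and restriction monoids over arbitrary types.\<close>

definition admissible :: "'x set \<Rightarrow> 'x list rterm set \<times> 'x list rterm set \<Rightarrow> bool" where
  "admissible X e \<longleftrightarrow>
    (\<forall>(M :: 'x list monoid) (S :: 'x list rterm set restr_monoid) \<gamma>.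
       monoid M \<longrightarrow> restriction_monoid S \<longrightarrow> \<gamma> \<in> monoid_mor M S \<longrightarrow> satisfies_identity X M S \<gamma> e)"


section \<open>The restriction monoid \<open>FR_R(M)\<close>\<close>

definition FRR_relations ::
    "'x set \<Rightarrow> ('x list rterm set \<times> 'x list rterm set) set \<Rightarrow> ('m, 'z) monoid_scheme
      \<Rightarrow> ('m rterm set \<times> 'm rterm set) set" where
  "FRR_relations X R M =
    (let F = FR (carrier M); \<iota> = FR_gen (carrier M) in
      {(\<iota> \<one>\<^bsub>M\<^esub>, \<one>\<^bsub>F\<^esub>)} \<union>
      {(\<iota> m \<otimes>\<^bsub>F\<^esub> \<iota> n, \<iota> (m \<otimes>\<^bsub>M\<^esub> n) \<otimes>\<^bsub>F\<^esub> (\<iota> m \<otimes>\<^bsub>F\<^esub> \<iota> n)\<^sup>*\<^bsub>F\<^esub>) | m n.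
         m \<in> carrier M \<and> n \<in> carrier M} \<union>
      {(identity_value M F \<iota> f p, identity_value M F \<iota> f q) | p q f.
         (p, q) \<in> R \<and> f \<in> X \<rightarrow> carrier M})"

definition FRR ::
    "'x set \<Rightarrow> ('x list rterm set \<times> 'x list rterm set) set \<Rightarrow> ('m, 'z) monoid_scheme
      \<Rightarrow> 'm rterm set restr_monoid" where
  "FRR X R M = FR_presented (carrier M) (FRR_relations X R M)"


section \<open>Basic properties\<close>

lemma rterms_simps [simp]:
  "Gen a \<in> rterms A \<longleftrightarrow> a \<in> A" "One \<in> rterms A"
  "Mul s t \<in> rterms A \<longleftrightarrow> s \<in> rterms A \<and> t \<in> rterms A"
  "Star s \<in> rterms A \<longleftrightarrow> s \<in> rterms A" "Plus s \<in> rterms A \<longleftrightarrow> s \<in> rterms A"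
  by (auto simp: rterms_def)

lemma rcong_rterms: "(s, t) \<in> rcong A \<rho> \<Longrightarrow> s \<in> rterms A \<and> t \<in> rterms A"
  by (induction rule: rcong.induct) auto

lemma equiv_rcong: "equiv (rterms A) (rcong A \<rho>)"
  by (rule equivI) (auto simp: refl_on_def sym_def dest: rcong_rterms
      intro: rcong.refl rcong.sym intro!: transI elim: rcong.trans)

lemma rcong_class_eq:
  "s \<in> rterms A \<Longrightarrow> t \<in> rterms A \<Longrightarrow> rcong A \<rho> `` {s} = rcong A \<rho> `` {t} \<longleftrightarrow> (s, t) \<in> rcong A \<rho>"
  by (rule eq_equiv_class_iff [OF equiv_rcong])

lemma term_quot_simps:
  assumes "s \<in> rterms A" "t \<in> rterms A"
  shows "rcong A \<rho> `` {s} \<otimes>\<^bsub>term_quot A (rcong A \<rho>)\<^esub> rcong A \<rho> `` {t} = rcong A \<rho> `` {Mul s t}"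
    and "(rcong A \<rho> `` {s})\<^sup>*\<^bsub>term_quot A (rcong A \<rho>)\<^esub> = rcong A \<rho> `` {Star s}"
    and "(rcong A \<rho> `` {s})\<^sup>+\<^bsub>term_quot A (rcong A \<rho>)\<^esub> = rcong A \<rho> `` {Plus s}"
    and "\<one>\<^bsub>term_quot A (rcong A \<rho>)\<^esub> = rcong A \<rho> `` {One}"
proof -
  note E = equiv_rcong [of A \<rho>]
  have "congruent2 (rcong A \<rho>) (rcong A \<rho>) (\<lambda>s t. rcong A \<rho> `` {Mul s t})"
    using equiv_class_eq [OF E] by (intro congruent2I') (blast intro: rcong.Mul)
  from UN_equiv_class2 [OF E E this assms]
  show "rcong A \<rho> `` {s} \<otimes>\<^bsub>term_quot A (rcong A \<rho>)\<^esub> rcong A \<rho> `` {t} = rcong A \<rho> `` {Mul s t}"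
    by (simp add: term_quot_def)
  have "congruent (rcong A \<rho>) (\<lambda>s. rcong A \<rho> `` {Star s})"
    using equiv_class_eq [OF E] by (intro congruentI) (blast intro: rcong.Star)
  from UN_equiv_class [OF E this assms(1)]
  show "(rcong A \<rho> `` {s})\<^sup>*\<^bsub>term_quot A (rcong A \<rho>)\<^esub> = rcong A \<rho> `` {Star s}"
    by (simp add: term_quot_def)
  have "congruent (rcong A \<rho>) (\<lambda>s. rcong A \<rho> `` {Plus s})"
    using equiv_class_eq [OF E] by (intro congruentI) (blast intro: rcong.Plus)
  from UN_equiv_class [OF E this assms(1)]
  show "(rcong A \<rho> `` {s})\<^sup>+\<^bsub>term_quot A (rcong A \<rho>)\<^esub> = rcong A \<rho> `` {Plus s}"
    by (simp add: term_quot_def)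
qed (simp add: term_quot_def)

lemma term_quot_carrierE:
  assumes "P \<in> carrier (term_quot A (rcong A \<rho>))"
  obtains s where "s \<in> rterms A" "P = rcong A \<rho> `` {s}"
  using assms by (auto simp: term_quot_def elim: quotientE)

lemma term_quot_carrierI:
  "s \<in> rterms A \<Longrightarrow> rcong A \<rho> `` {s} \<in> carrier (term_quot A (rcong A \<rho>))"
  by (simp add: term_quot_def quotientI)

lemma restriction_monoid_term_quot: "restriction_monoid (term_quot A (rcong A \<rho>))"
  by unfold_locales
    ((elim term_quot_carrierE)?;
     simp add: term_quot_simps term_quot_simps(4) [where s = One and t = One] term_quot_carrierI
       rcong_class_eq rcong.assoc rcong.l_one rcong.r_one
       rcong.plus_mult rcong.plus_commute rcong.plus_plus_mult rcong.mult_plus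
       rcong.mult_star rcong.star_commute rcong.star_mult_star rcong.star_mult
       rcong.star_plus rcong.plus_star)+

lemma eval_closed:
  assumes "restriction_monoid S" "g \<in> A \<rightarrow> carrier S" "t \<in> rterms A"
  shows "eval S g t \<in> carrier S"
proof -
  interpret restriction_monoid S by fact
  show ?thesis using assms(3) by (induction t) (use assms(2) in auto)
qed

lemma rcong_sound:
  assumes "restriction_monoid S" "g \<in> A \<rightarrow> carrier S"
    and \<rho>: "\<And>s t. (s, t) \<in> \<rho> \<Longrightarrow> s \<in> rterms A \<Longrightarrow> t \<in> rterms A \<Longrightarrow> eval S g s = eval S g t"
    and "(s, t) \<in> rcong A \<rho>"
  shows "eval S g s = eval S g t"
proof -
  interpret S: restriction_monoid S by fact
  note [simp] = eval_closed [OF assms(1,2)]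
  show ?thesis using assms(4)
  proof (induction rule: rcong.induct)
    case (mult_plus x y) show ?case unfolding eval.simps by (rule S.mult_plus) (simp_all add: mult_plus)
  next
    case (star_mult x y) show ?case unfolding eval.simps by (rule S.star_mult) (simp_all add: star_mult)
  next
    case (plus_commute x y) show ?case unfolding eval.simps by (rule S.plus_commute) (simp_all add: plus_commute)
  next
    case (star_commute x y) show ?case unfolding eval.simps by (rule S.star_commute) (simp_all add: star_commute)
  qed (simp_all add: \<rho> S.m_assoc S.plus_mult S.plus_plus_mult S.mult_star
      S.star_mult_star S.star_plus S.plus_star)
qed

lemma FR_carrierE:
  assumes "p \<in> carrier (FR A)"
  obtains t where "t \<in> rterms A" "p = FR_class A t"
  using assms unfolding FR_def FR_class_def by (rule term_quot_carrierE)

lemma restriction_monoid_FR: "restriction_monoid (FR A)"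
  unfolding FR_def by (rule restriction_monoid_term_quot)

lemma FR_lift_class:
  assumes "restriction_monoid S" "g \<in> A \<rightarrow> carrier S" "t \<in> rterms A"
  shows "FR_lift S g (FR_class A t) = eval S g t"
proof -
  have "eval S g s = eval S g t" if "(t, s) \<in> rcong A {}" for s
    using rcong_sound [OF assms(1,2) _ that] by simp
  moreover have "(t, t) \<in> rcong A {}" by (rule rcong.refl [OF assms(3)])
  ultimately have "eval S g ` (rcong A {} `` {t}) = {eval S g t}" by blast
  then show ?thesis by (simp add: FR_lift_def FR_class_def)
qed

lemma FR_simps:
  assumes "s \<in> rterms A" "t \<in> rterms A"
  shows "FR_class A s \<otimes>\<^bsub>FR A\<^esub> FR_class A t = FR_class A (Mul s t)"
    and "(FR_class A s)\<^sup>*\<^bsub>FR A\<^esub> = FR_class A (Star s)"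
    and "(FR_class A s)\<^sup>+\<^bsub>FR A\<^esub> = FR_class A (Plus s)"
    and "\<one>\<^bsub>FR A\<^esub> = FR_class A One"
  using assms by (simp_all add: FR_def FR_class_def term_quot_simps)

lemma FR_lift_mor:
  assumes "restriction_monoid S" "g \<in> A \<rightarrow> carrier S"
  shows "FR_lift S g \<in> restriction_mor (FR A) S"
  using assms
  by (auto simp: restriction_mor_def monoid_mor_def hom_def FR_simps FR_lift_class eval_closed
      FR_simps(4) [where s = One and t = One] elim!: FR_carrierE)

lemma FR_lift_gen:
  assumes "restriction_monoid S" "g \<in> A \<rightarrow> carrier S" "a \<in> A"
  shows "FR_lift S g (FR_gen A a) = g a"
  using assms by (simp add: FR_gen_def FR_lift_class)

lemma FR_class_carrier: "t \<in> rterms A \<Longrightarrow> FR_class A t \<in> carrier (FR A)"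
  by (simp add: FR_def FR_class_def term_quot_carrierI)

lemma FR_lift_unique:
  assumes S: "restriction_monoid S" and h: "h \<in> restriction_mor (FR A) S"
    and gen: "\<And>a. a \<in> A \<Longrightarrow> h (FR_gen A a) = g a" and p: "p \<in> carrier (FR A)"
  shows "h p = FR_lift S g p"
proof -
  have gA: "g \<in> A \<rightarrow> carrier S"
  proof
    fix a assume a: "a \<in> A"
    then have "FR_gen A a \<in> carrier (FR A)" by (simp add: FR_gen_def FR_class_carrier)
    then have "h (FR_gen A a) \<in> carrier S"
      using h by (auto simp: restriction_mor_def monoid_mor_def hom_def)
    with gen [OF a] show "g a \<in> carrier S" by simp
  qed
  have "h (FR_class A t) = eval S g t" if "t \<in> rterms A" for t
    using that
  proof (induction t)
    case (Gen a) then show ?case using gen by (simp add: FR_gen_def)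
  next
    case One
    then show ?case using h FR_simps(4) [of One A One] by (simp add: restriction_mor_def monoid_mor_def)
  next
    case (Mul s t)
    then show ?case using h
      by (simp add: restriction_mor_def monoid_mor_def hom_def FR_class_carrier
          flip: FR_simps(1))
  next
    case (Star t)
    then show ?case using h
      by (simp add: restriction_mor_def FR_class_carrier flip: FR_simps(2))
  next
    case (Plus t)
    then show ?case using h
      by (simp add: restriction_mor_def FR_class_carrier flip: FR_simps(3))
  qed
  with p show ?thesis by (auto elim!: FR_carrierE simp: FR_lift_class [OF S gA])
qed

lemma restriction_monoid_FRR: "restriction_monoid (FRR X R M)"
  unfolding FRR_def FR_presented_def by (rule restriction_monoid_term_quot)

lemma eval_term_quot:
  assumes "t \<in> rterms A"
  shows "eval (term_quot A (rcong A \<rho>)) (\<lambda>a. rcong A \<rho> `` {Gen a}) t = rcong A \<rho> `` {t}"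
  using assms by (induction t) (simp_all add: term_quot_simps term_quot_simps(4) [where s = One and t = One])

lemma word_ext_closed:
  assumes "monoid M" "f \<in> X \<rightarrow> carrier M" "u \<in> lists X"
  shows "word_ext M f u \<in> carrier M"
proof -
  interpret monoid M by fact
  show ?thesis using assms(3) by (induction u) (use assms(2) in \<open>auto simp: word_ext_def\<close>)
qed

lemma word_ext_append:
  assumes "monoid M" "f \<in> X \<rightarrow> carrier M" "u \<in> lists X" "v \<in> lists X"
  shows "word_ext M f (u @ v) = word_ext M f u \<otimes>\<^bsub>M\<^esub> word_ext M f v"
proof -
  interpret monoid M by fact
  have *: "word_ext M f v \<in> carrier M" using assms word_ext_closed by metis
  show ?thesis using assms(3)
  proof (induction u)
    case Nil
    then show ?case using * by (simp add: word_ext_def)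
  next
    case (Cons x u)
    then have "word_ext M f u \<in> carrier M" "f x \<in> carrier M"
      using assms word_ext_closed [of M f X u] by auto
    with Cons * show ?case by (simp add: word_ext_def m_assoc)
  qed
qed

theorem admissible_all_types:
  fixes X :: "'x set" and M :: "('m, 'y) monoid_scheme" and S :: "('s, 'z) restr_monoid_scheme"
  assumes adm: "admissible X e" and e: "e \<in> identities X"
    and M: "monoid M" and S: "restriction_monoid S" and \<gamma>: "\<gamma> \<in> monoid_mor M S"
  shows "satisfies_identity X M S \<gamma> e"
  unfolding satisfies_identity_def
proof
  fix f assume f: "f \<in> X \<rightarrow> carrier M"
  define A where "A = lists X"
  define g where "g = (\<lambda>u. \<gamma> (word_ext M f u))"
  have gA: "g \<in> A \<rightarrow> carrier S"
    using \<gamma> word_ext_closed [OF M f] by (auto simp: g_def A_def monoid_mor_def hom_def)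
  have g_append: "g (u @ v) = g u \<otimes>\<^bsub>S\<^esub> g v" if "u \<in> A" "v \<in> A" for u v
    using \<gamma> that word_ext_closed [OF M f] word_ext_append [OF M f]
    by (auto simp: g_def A_def monoid_mor_def hom_def)
  have g_Nil: "g [] = \<one>\<^bsub>S\<^esub>"
    using \<gamma> by (simp add: g_def monoid_mor_def word_ext_def)
  define \<theta> where "\<theta> = rcong A {(s, t). eval S g s = eval S g t}"
  have \<theta>_iff: "(s, t) \<in> \<theta> \<longleftrightarrow> eval S g s = eval S g t" if "s \<in> rterms A" "t \<in> rterms A" for s t
  proof
    assume "(s, t) \<in> \<theta>"
    then show "eval S g s = eval S g t"
      unfolding \<theta>_def by (rule rcong_sound [OF S gA, rotated]) simp
  next
    assume "eval S g s = eval S g t"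
    with that show "(s, t) \<in> \<theta>" by (simp add: \<theta>_def rcong.rel)
  qed
  define M' :: "'x list monoid" where "M' = \<lparr>carrier = A, monoid.mult = (@), one = []\<rparr>"
  define S' where "S' = term_quot A \<theta>"
  define \<gamma>' where "\<gamma>' = (\<lambda>u. \<theta> `` {Gen u})"
  have M': "monoid M'"
    by (rule monoidI) (auto simp: M'_def A_def)
  have S': "restriction_monoid S'"
    unfolding S'_def \<theta>_def by (rule restriction_monoid_term_quot)
  have gen: "\<gamma>' \<in> A \<rightarrow> carrier S'"
    by (auto simp: \<gamma>'_def S'_def \<theta>_def term_quot_carrierI)
  have "\<gamma>' \<in> monoid_mor M' S'"
    unfolding monoid_mor_def hom_def
  proof (intro CollectI conjI ballI)
    show "\<gamma>' \<in> carrier M' \<rightarrow> carrier S'" using gen by (simp add: M'_def)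
    show "\<gamma>' \<one>\<^bsub>M'\<^esub> = \<one>\<^bsub>S'\<^esub>"
      using \<theta>_iff [of "Gen []" One] g_Nil
      by (simp add: M'_def S'_def \<gamma>'_def \<theta>_def term_quot_simps(4) [where s = One and t = One]
          rcong_class_eq A_def)
    fix u v assume "u \<in> carrier M'" "v \<in> carrier M'"
    then have uv: "u \<in> A" "v \<in> A" "u @ v \<in> A" by (auto simp: M'_def A_def)
    then have "(Gen (u @ v), Mul (Gen u) (Gen v)) \<in> \<theta>"
      by (simp add: \<theta>_iff g_append)
    with uv show "\<gamma>' (u \<otimes>\<^bsub>M'\<^esub> v) = \<gamma>' u \<otimes>\<^bsub>S'\<^esub> \<gamma>' v"
      by (simp add: M'_def S'_def \<gamma>'_def \<theta>_def term_quot_simps rcong_class_eq)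
  qed
  with adm M' S' have sat: "satisfies_identity X M' S' \<gamma>' e"
    unfolding admissible_def by blast
  have f': "(\<lambda>x. [x]) \<in> X \<rightarrow> carrier M'" by (auto simp: M'_def A_def)
  have [simp]: "word_ext M' (\<lambda>x. [x]) u = u" for u
    by (induction u) (simp_all add: word_ext_def M'_def)
  have eq: "FR_lift S' \<gamma>' (fst e) = FR_lift S' \<gamma>' (snd e)"
    using bspec [OF sat [unfolded satisfies_identity_def] f'] by (simp add: identity_value_def)
  obtain p q where pq: "p \<in> rterms A" "q \<in> rterms A" "fst e = FR_class A p" "snd e = FR_class A q"
    using e by (auto simp: identities_def A_def elim!: FR_carrierE)
  have "FR_lift S' \<gamma>' (FR_class A t) = \<theta> `` {t}" if "t \<in> rterms A" for t
    using that FR_lift_class [OF S' gen that] eval_term_quot [OF that]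
    by (simp add: S'_def \<gamma>'_def \<theta>_def)
  with eq pq have "\<theta> `` {p} = \<theta> `` {q}" by simp
  then have "(p, q) \<in> \<theta>" using pq by (simp add: \<theta>_def rcong_class_eq)
  then have "eval S g p = eval S g q" using pq by (simp add: \<theta>_iff)
  then show "identity_value M S \<gamma> f (fst e) = identity_value M S \<gamma> f (snd e)"
    using pq FR_lift_class [OF S gA] by (simp add: identity_value_def g_def)
qed

end

theory Submission
  imports Defs
begin

text \<open>Let \<open>T\<close> be the monoid \<open>M\<close> with \<open>x\<^sup>* = x\<^sup>+ = 1\<close>. The identity map
  \<open>M \<rightarrow> T\<close> satisfies every admissible identity, so it induces a morphism \<open>\<phi>\<close> from
  \<open>S = FR\<^sub>R(M)\<close> onto \<open>M\<close> that kills all projections. Conversely the relations rewrite every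
  element of \<open>S\<close> as \<open>s = \<lfloor>\<phi> s\<rfloor>s\<^sup>* = s\<^sup>+\<lfloor>\<phi> s\<rfloor>\<close>, so \<open>s\<close> is determined by \<open>\<phi> s\<close>
  together with \<open>s\<^sup>*\<close>, and also by \<open>\<phi> s\<close> together with \<open>s\<^sup>+\<close> (\<open>S\<close> is proper). If \<open>us = ut\<close>
  and \<open>M\<close> is left cancellative, then \<open>u\<^sup>*s\<close> and \<open>u\<^sup>*t\<close> agree under \<open>\<phi>\<close> and under \<open>\<^sup>*\<close>, hence
  coincide. Conversely, if \<open>us = ut\<close> in \<open>M\<close>, then \<open>\<lfloor>u\<rfloor>\<lfloor>s\<rfloor>\<close> and \<open>\<lfloor>u\<rfloor>\<lfloor>t\<rfloor>\<close> become equal after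
  multiplication by suitable projections; right ampleness cancels \<open>\<lfloor>u\<rfloor>\<close> up to projections, and
  \<open>\<phi>\<close> gives \<open>s = t\<close>.\<close>

section \<open>Two consequences of the restriction axioms\<close>

context restriction_monoid
begin

lemma star_star [simp]: "x \<in> carrier S \<Longrightarrow> (x\<^sup>*)\<^sup>* = x\<^sup>*"
  using plus_star star_plus star_closed by metis

text \<open>By \<open>star_mult\<close> the left side is the star of
  \<open>y \<otimes> (x \<otimes> y)\<^sup>*\<close>, that is
  \<open>y\<^sup>* \<otimes> (x \<otimes> y)\<^sup>*\<close>. The factor \<open>y\<^sup>*\<close> is
  absorbed because it fixes \<open>x \<otimes> y\<close> on the right.\<close>

lemma star_mult_eq:
  assumes "x \<in> carrier S" "y \<in> carrier S"
  shows "(x\<^sup>* \<otimes> y)\<^sup>* = (x \<otimes> y)\<^sup>*"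
proof -
  have "(x \<otimes> y) \<otimes> y\<^sup>* = x \<otimes> y"
    using assms by (simp add: m_assoc mult_star)
  then have "(x \<otimes> y)\<^sup>* \<otimes> y\<^sup>* = (x \<otimes> y)\<^sup>*"
    using assms by (metis star_mult_star m_closed)
  moreover have "(x\<^sup>* \<otimes> y)\<^sup>* = y\<^sup>* \<otimes> (x \<otimes> y)\<^sup>*"
    using assms by (simp add: star_mult [of x y] star_mult_star)
  ultimately show ?thesis
    using assms by (simp add: star_commute)
qed

text \<open>Dual argument: \<open>mult_plus\<close> produces
  \<open>(x \<otimes> y)\<^sup>+ \<otimes> x\<^sup>+\<close>, and \<open>x\<^sup>+\<close> is
  absorbed because it fixes \<open>x \<otimes> y\<close> on the left.\<close>

lemma mult_plus_eq:
  assumes "x \<in> carrier S" "y \<in> carrier S"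
  shows "(x \<otimes> y\<^sup>+)\<^sup>+ = (x \<otimes> y)\<^sup>+"
proof -
  have "x\<^sup>+ \<otimes> (x \<otimes> y) = x \<otimes> y"
    using assms by (simp add: plus_mult flip: m_assoc)
  then have "x\<^sup>+ \<otimes> (x \<otimes> y)\<^sup>+ = (x \<otimes> y)\<^sup>+"
    using assms by (metis plus_plus_mult m_closed)
  moreover have "(x \<otimes> y\<^sup>+)\<^sup>+ = (x \<otimes> y)\<^sup>+ \<otimes> x\<^sup>+"
    using assms by (simp add: mult_plus [of x y] plus_plus_mult)
  ultimately show ?thesis
    using assms by (simp add: plus_commute)
qed

end

section \<open>Proper restriction monoids over a monoid\<close>

text \<open>Isolates the facts about \<open>FRR X R M\<close> from which the equivalences follow, so
  that their proofs involve neither terms nor congruences. Here \<iota> stands for the generators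
  and \<phi> for the morphism onto \<open>M\<close> that sends every projection to the
  identity.\<close>

locale proper_expansion = S: restriction_monoid S + M: monoid M
  for S :: "('s, 'y) restr_monoid_scheme" and M :: "('m, 'z) monoid_scheme" +
  fixes \<iota> :: "'m \<Rightarrow> 's" and \<phi> :: "'s \<Rightarrow> 'm"
  assumes gen_closed [simp]: "m \<in> carrier M \<Longrightarrow> \<iota> m \<in> carrier S"
    and gen_mult: "\<lbrakk>m \<in> carrier M; n \<in> carrier M\<rbrakk> \<Longrightarrow>
      \<iota> m \<otimes>\<^bsub>S\<^esub> \<iota> n = \<iota> (m \<otimes>\<^bsub>M\<^esub> n) \<otimes>\<^bsub>S\<^esub> (\<iota> m \<otimes>\<^bsub>S\<^esub> \<iota> n)\<^sup>*\<^bsub>S\<^esub>"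
    and proj_closed [simp]: "s \<in> carrier S \<Longrightarrow> \<phi> s \<in> carrier M"
    and proj_mult [simp]: "\<lbrakk>s \<in> carrier S; t \<in> carrier S\<rbrakk> \<Longrightarrow> \<phi> (s \<otimes>\<^bsub>S\<^esub> t) = \<phi> s \<otimes>\<^bsub>M\<^esub> \<phi> t"
    and proj_star [simp]: "s \<in> carrier S \<Longrightarrow> \<phi> (s\<^sup>*\<^bsub>S\<^esub>) = \<one>\<^bsub>M\<^esub>"
    and proj_plus [simp]: "s \<in> carrier S \<Longrightarrow> \<phi> (s\<^sup>+\<^bsub>S\<^esub>) = \<one>\<^bsub>M\<^esub>"
    and proj_gen [simp]: "m \<in> carrier M \<Longrightarrow> \<phi> (\<iota> m) = m"
    and decomp_star: "s \<in> carrier S \<Longrightarrow> s = \<iota> (\<phi> s) \<otimes>\<^bsub>S\<^esub> s\<^sup>*\<^bsub>S\<^esub>"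
begin

text \<open>Moving the projection \<open>s\<^sup>*\<close> across \<open>\<iota> (\<phi> s)\<close>
  with \<open>mult_plus\<close> turns it into the plus of
  \<open>\<iota> (\<phi> s) \<otimes> s\<^sup>*\<close>, which is \<open>s\<^sup>+\<close>.\<close>

lemma decomp_plus:
  assumes "s \<in> carrier S"
  shows "s = s\<^sup>+\<^bsub>S\<^esub> \<otimes>\<^bsub>S\<^esub> \<iota> (\<phi> s)"
proof -
  have "\<iota> (\<phi> s) \<otimes>\<^bsub>S\<^esub> (s\<^sup>*\<^bsub>S\<^esub>)\<^sup>+\<^bsub>S\<^esub> = (\<iota> (\<phi> s) \<otimes>\<^bsub>S\<^esub> s\<^sup>*\<^bsub>S\<^esub>)\<^sup>+\<^bsub>S\<^esub> \<otimes>\<^bsub>S\<^esub> \<iota> (\<phi> s)"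
    using assms by (simp add: S.mult_plus)
  with assms show ?thesis
    by (simp add: S.plus_star flip: decomp_star)
qed

lemma eq_by_star:
  "\<lbrakk>s \<in> carrier S; t \<in> carrier S; \<phi> s = \<phi> t; s\<^sup>*\<^bsub>S\<^esub> = t\<^sup>*\<^bsub>S\<^esub>\<rbrakk> \<Longrightarrow> s = t"
  using decomp_star by metis

lemma eq_by_plus:
  "\<lbrakk>s \<in> carrier S; t \<in> carrier S; \<phi> s = \<phi> t; s\<^sup>+\<^bsub>S\<^esub> = t\<^sup>+\<^bsub>S\<^esub>\<rbrakk> \<Longrightarrow> s = t"
  using decomp_plus by metis

text \<open>The left-handed form of the defining relation \<open>gen_mult\<close>, obtained from the
  decomposition since \<phi> maps the product of the two generators to the product in
  \<open>M\<close>.\<close>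

lemma gen_mult_plus:
  assumes "m \<in> carrier M" "n \<in> carrier M"
  shows "\<iota> m \<otimes>\<^bsub>S\<^esub> \<iota> n = (\<iota> m \<otimes>\<^bsub>S\<^esub> \<iota> n)\<^sup>+\<^bsub>S\<^esub> \<otimes>\<^bsub>S\<^esub> \<iota> (m \<otimes>\<^bsub>M\<^esub> n)"
  using decomp_plus [of "\<iota> m \<otimes>\<^bsub>S\<^esub> \<iota> n"] assms by simp

section \<open>From cancellativity of the monoid to ampleness\<close>

lemma right_ample_if_left_cancellative:
  assumes "left_cancellative M"
  shows "right_ample S"
  unfolding right_ample_def
proof (intro ballI impI)
  fix s t u
  assume c [simp]: "s \<in> carrier S" "t \<in> carrier S" "u \<in> carrier S"
    and eq: "u \<otimes>\<^bsub>S\<^esub> s = u \<otimes>\<^bsub>S\<^esub> t"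
  have "\<phi> u \<otimes>\<^bsub>M\<^esub> \<phi> s = \<phi> u \<otimes>\<^bsub>M\<^esub> \<phi> t"
    using arg_cong [OF eq, of \<phi>] by simp
  then have "\<phi> s = \<phi> t"
    using assms c proj_closed unfolding left_cancellative_def by blast
  then have "\<phi> (u\<^sup>*\<^bsub>S\<^esub> \<otimes>\<^bsub>S\<^esub> s) = \<phi> (u\<^sup>*\<^bsub>S\<^esub> \<otimes>\<^bsub>S\<^esub> t)"
    by simp
  \<comment> \<open>By \<open>star_mult_eq\<close> the two sides have the stars of
    \<open>u \<otimes> s\<close> and \<open>u \<otimes> t\<close>, which are equal.\<close>
  then show "u\<^sup>*\<^bsub>S\<^esub> \<otimes>\<^bsub>S\<^esub> s = u\<^sup>*\<^bsub>S\<^esub> \<otimes>\<^bsub>S\<^esub> t"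
    by (rule eq_by_star [rotated 2]) (simp_all add: S.star_mult_eq eq)
qed

lemma left_ample_if_right_cancellative:
  assumes "right_cancellative M"
  shows "left_ample S"
  unfolding left_ample_def
proof (intro ballI impI)
  fix s t u
  assume c [simp]: "s \<in> carrier S" "t \<in> carrier S" "u \<in> carrier S"
    and eq: "s \<otimes>\<^bsub>S\<^esub> u = t \<otimes>\<^bsub>S\<^esub> u"
  have "\<phi> s \<otimes>\<^bsub>M\<^esub> \<phi> u = \<phi> t \<otimes>\<^bsub>M\<^esub> \<phi> u"
    using arg_cong [OF eq, of \<phi>] by simp
  then have "\<phi> s = \<phi> t"
    using assms c proj_closed unfolding right_cancellative_def by blast
  then have "\<phi> (s \<otimes>\<^bsub>S\<^esub> u\<^sup>+\<^bsub>S\<^esub>) = \<phi> (t \<otimes>\<^bsub>S\<^esub> u\<^sup>+\<^bsub>S\<^esub>)"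
    by simp
  then show "s \<otimes>\<^bsub>S\<^esub> u\<^sup>+\<^bsub>S\<^esub> = t \<otimes>\<^bsub>S\<^esub> u\<^sup>+\<^bsub>S\<^esub>"
    by (rule eq_by_plus [rotated 2]) (simp_all add: S.mult_plus_eq eq)
qed

section \<open>From ampleness to cancellativity of the monoid\<close>

lemma left_cancellative_if_right_ample:
  assumes "right_ample S"
  shows "left_cancellative M"
  unfolding left_cancellative_def
proof (intro ballI impI)
  fix u s t
  assume c [simp]: "u \<in> carrier M" "s \<in> carrier M" "t \<in> carrier M"
    and eq: "u \<otimes>\<^bsub>M\<^esub> s = u \<otimes>\<^bsub>M\<^esub> t"
  define a where "a = \<iota> u \<otimes>\<^bsub>S\<^esub> \<iota> s"
  define b where "b = \<iota> u \<otimes>\<^bsub>S\<^esub> \<iota> t"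
  have [simp]: "a \<in> carrier S" "b \<in> carrier S" by (simp_all add: a_def b_def)
  have a: "a = \<iota> (u \<otimes>\<^bsub>M\<^esub> s) \<otimes>\<^bsub>S\<^esub> a\<^sup>*\<^bsub>S\<^esub>" and b: "b = \<iota> (u \<otimes>\<^bsub>M\<^esub> s) \<otimes>\<^bsub>S\<^esub> b\<^sup>*\<^bsub>S\<^esub>"
    using gen_mult [of u s] gen_mult [of u t] by (simp_all add: a_def b_def eq)
  \<comment> \<open>Both \<open>a\<close> and \<open>b\<close> are restrictions of the same
    generator, so restricting each by the star of the other gives the same element.\<close>
  have "a \<otimes>\<^bsub>S\<^esub> b\<^sup>*\<^bsub>S\<^esub> = \<iota> (u \<otimes>\<^bsub>M\<^esub> s) \<otimes>\<^bsub>S\<^esub> (a\<^sup>*\<^bsub>S\<^esub> \<otimes>\<^bsub>S\<^esub> b\<^sup>*\<^bsub>S\<^esub>)"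
    by (subst a) (simp add: S.m_assoc)
  also have "\<dots> = b \<otimes>\<^bsub>S\<^esub> a\<^sup>*\<^bsub>S\<^esub>"
    \<comment> \<open>Only the factor \<open>b\<close> is expanded; its other occurrence, inside
      \<open>b\<^sup>*\<close>, stays.\<close>
    by (subst (2) b) (simp add: S.m_assoc S.star_commute)
  finally have "\<iota> u \<otimes>\<^bsub>S\<^esub> (\<iota> s \<otimes>\<^bsub>S\<^esub> b\<^sup>*\<^bsub>S\<^esub>) = \<iota> u \<otimes>\<^bsub>S\<^esub> (\<iota> t \<otimes>\<^bsub>S\<^esub> a\<^sup>*\<^bsub>S\<^esub>)"
    by (simp add: a_def b_def S.m_assoc)
  then have "(\<iota> u)\<^sup>*\<^bsub>S\<^esub> \<otimes>\<^bsub>S\<^esub> (\<iota> s \<otimes>\<^bsub>S\<^esub> b\<^sup>*\<^bsub>S\<^esub>) = (\<iota> u)\<^sup>*\<^bsub>S\<^esub> \<otimes>\<^bsub>S\<^esub> (\<iota> t \<otimes>\<^bsub>S\<^esub> a\<^sup>*\<^bsub>S\<^esub>)"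
    using assms unfolding right_ample_def by simp
  \<comment> \<open>All projections become the identity under \<phi>, leaving only \<open>s\<close>
    and \<open>t\<close>.\<close>
  from arg_cong [OF this, of \<phi>] show "s = t" by simp
qed

lemma right_cancellative_if_left_ample:
  assumes "left_ample S"
  shows "right_cancellative M"
  unfolding right_cancellative_def
proof (intro ballI impI)
  fix u s t
  assume c [simp]: "u \<in> carrier M" "s \<in> carrier M" "t \<in> carrier M"
    and eq: "s \<otimes>\<^bsub>M\<^esub> u = t \<otimes>\<^bsub>M\<^esub> u"
  define a where "a = \<iota> s \<otimes>\<^bsub>S\<^esub> \<iota> u"
  define b where "b = \<iota> t \<otimes>\<^bsub>S\<^esub> \<iota> u"
  have [simp]: "a \<in> carrier S" "b \<in> carrier S" by (simp_all add: a_def b_def)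
  have a: "a = a\<^sup>+\<^bsub>S\<^esub> \<otimes>\<^bsub>S\<^esub> \<iota> (s \<otimes>\<^bsub>M\<^esub> u)" and b: "b = b\<^sup>+\<^bsub>S\<^esub> \<otimes>\<^bsub>S\<^esub> \<iota> (s \<otimes>\<^bsub>M\<^esub> u)"
    using gen_mult_plus [of s u] gen_mult_plus [of t u] by (simp_all add: a_def b_def eq)
  \<comment> \<open>Dually, \<open>a\<close> and \<open>b\<close> are restrictions of one generator
    from the left, so their common restriction is reached by multiplying with plus projections on
    the left.\<close>
  have "b\<^sup>+\<^bsub>S\<^esub> \<otimes>\<^bsub>S\<^esub> a = (b\<^sup>+\<^bsub>S\<^esub> \<otimes>\<^bsub>S\<^esub> a\<^sup>+\<^bsub>S\<^esub>) \<otimes>\<^bsub>S\<^esub> \<iota> (s \<otimes>\<^bsub>M\<^esub> u)"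
    by (subst a) (simp add: S.m_assoc)
  also have "\<dots> = (a\<^sup>+\<^bsub>S\<^esub> \<otimes>\<^bsub>S\<^esub> b\<^sup>+\<^bsub>S\<^esub>) \<otimes>\<^bsub>S\<^esub> \<iota> (s \<otimes>\<^bsub>M\<^esub> u)"
    by (simp add: S.plus_commute)
  also have "\<dots> = a\<^sup>+\<^bsub>S\<^esub> \<otimes>\<^bsub>S\<^esub> b"
    by (subst (2) b) (simp add: S.m_assoc)
  finally have "(b\<^sup>+\<^bsub>S\<^esub> \<otimes>\<^bsub>S\<^esub> \<iota> s) \<otimes>\<^bsub>S\<^esub> \<iota> u = (a\<^sup>+\<^bsub>S\<^esub> \<otimes>\<^bsub>S\<^esub> \<iota> t) \<otimes>\<^bsub>S\<^esub> \<iota> u"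
    by (simp add: a_def b_def S.m_assoc)
  then have "(b\<^sup>+\<^bsub>S\<^esub> \<otimes>\<^bsub>S\<^esub> \<iota> s) \<otimes>\<^bsub>S\<^esub> (\<iota> u)\<^sup>+\<^bsub>S\<^esub> = (a\<^sup>+\<^bsub>S\<^esub> \<otimes>\<^bsub>S\<^esub> \<iota> t) \<otimes>\<^bsub>S\<^esub> (\<iota> u)\<^sup>+\<^bsub>S\<^esub>"
    using assms unfolding left_ample_def by simp
  from arg_cong [OF this, of \<phi>] show "s = t" by simp
qed

end

section \<open>The monoid as a restriction monoid with trivial projections\<close>

definition trivial_restr :: "('m, 'z) monoid_scheme \<Rightarrow> 'm restr_monoid" where
  "trivial_restr M = \<lparr>carrier = carrier M, monoid.mult = monoid.mult M, one = \<one>\<^bsub>M\<^esub>,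
     rstar = (\<lambda>_. \<one>\<^bsub>M\<^esub>), rplus = (\<lambda>_. \<one>\<^bsub>M\<^esub>)\<rparr>"

lemma trivial_restr_simps [simp]:
  "carrier (trivial_restr M) = carrier M"
  "x \<otimes>\<^bsub>trivial_restr M\<^esub> y = x \<otimes>\<^bsub>M\<^esub> y"
  "\<one>\<^bsub>trivial_restr M\<^esub> = \<one>\<^bsub>M\<^esub>"
  "x\<^sup>*\<^bsub>trivial_restr M\<^esub> = \<one>\<^bsub>M\<^esub>"
  "x\<^sup>+\<^bsub>trivial_restr M\<^esub> = \<one>\<^bsub>M\<^esub>"
  by (simp_all add: trivial_restr_def)

lemma restriction_monoid_trivial_restr:
  assumes "monoid M"
  shows "restriction_monoid (trivial_restr M)"
proof -
  interpret monoid M by fact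
  show ?thesis by unfold_locales (simp_all add: m_assoc)
qed

lemma restriction_mor_eval:
  assumes h: "h \<in> restriction_mor S T" and S: "restriction_monoid S"
    and g: "g \<in> A \<rightarrow> carrier S" and t: "t \<in> rterms A"
  shows "h (eval S g t) = eval T (\<lambda>a. h (g a)) t"
  using t
proof (induction t)
  case One
  with h show ?case by (simp add: restriction_mor_def monoid_mor_def)
qed (use h eval_closed [OF S g] in \<open>auto simp: restriction_mor_def monoid_mor_def hom_def\<close>)

lemma eval_cong:
  assumes "\<And>a. a \<in> A \<Longrightarrow> g a = g' a" "t \<in> rterms A"
  shows "eval S g t = eval S g' t"
  using assms(2) by (induction t) (auto simp: assms(1))

text \<open>With projections sent to the identity, the first two kinds of relation become monoid
  laws. The identities in \<open>R\<close> hold because \<open>id\<close> is a monoid morphism from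
  \<open>M\<close> to \<open>trivial_restr M\<close>. This is what makes \<phi> well defined on the
  quotient.\<close>

lemma FRR_relations_trivial:
  assumes M: "monoid M" and R: "R \<subseteq> identities X" and adm: "\<forall>e\<in>R. admissible X e"
    and rel: "(P, Q) \<in> FRR_relations X R M"
  shows "FR_lift (trivial_restr M) id P = FR_lift (trivial_restr M) id Q"
proof -
  define F where "F = FR (carrier M)"
  define h where "h = FR_lift (trivial_restr M) id"
  define j where "j = FR_gen (carrier M)"
  interpret M: monoid M by fact
  note T = restriction_monoid_trivial_restr [OF M]
  interpret F: restriction_monoid F unfolding F_def by (rule restriction_monoid_FR)
  have idT: "id \<in> carrier M \<rightarrow> carrier (trivial_restr M)" by simp
  have h: "h \<in> restriction_mor F (trivial_restr M)"
    unfolding F_def h_def by (rule FR_lift_mor [OF T idT])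
  have hj [simp]: "h (j m) = m" if "m \<in> carrier M" for m
    using FR_lift_gen [OF T idT that] by (simp add: h_def j_def)
  have j [simp]: "j m \<in> carrier F" if "m \<in> carrier M" for m
    using that by (simp add: j_def F_def FR_gen_def FR_class_carrier)
  have h_simps [simp]: "h \<one>\<^bsub>F\<^esub> = \<one>\<^bsub>M\<^esub>"
    "\<And>x y. \<lbrakk>x \<in> carrier F; y \<in> carrier F\<rbrakk> \<Longrightarrow> h (x \<otimes>\<^bsub>F\<^esub> y) = h x \<otimes>\<^bsub>M\<^esub> h y"
    "\<And>x. x \<in> carrier F \<Longrightarrow> h (x\<^sup>*\<^bsub>F\<^esub>) = \<one>\<^bsub>M\<^esub>"
    using h by (auto simp: restriction_mor_def monoid_mor_def hom_def)
  \<comment> \<open>Since \<open>h\<close> inverts \<open>j\<close> on \<open>M\<close>, applying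
    \<open>h\<close> to a value computed along \<open>j\<close> gives the value along
    \<open>id\<close>.\<close>
  have value_h: "h (identity_value M F j f p) = identity_value M (trivial_restr M) id f p"
    if f: "f \<in> X \<rightarrow> carrier M" and p: "p \<in> carrier (FR (lists X))" for f p
  proof -
    obtain t where t: "t \<in> rterms (lists X)" "p = FR_class (lists X) t"
      using p by (rule FR_carrierE)
    note w = word_ext_closed [OF M f]
    have g: "(\<lambda>u. j (word_ext M f u)) \<in> lists X \<rightarrow> carrier F"
      using w by auto
    have g': "(\<lambda>u. id (word_ext M f u)) \<in> lists X \<rightarrow> carrier (trivial_restr M)"
      using w by auto
    have "h (identity_value M F j f p) = h (eval F (\<lambda>u. j (word_ext M f u)) t)"
      by (simp add: identity_value_def t FR_lift_class [OF F.restriction_monoid_axioms g])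
    also have "\<dots> = eval (trivial_restr M) (\<lambda>u. h (j (word_ext M f u))) t"
      by (rule restriction_mor_eval [OF h F.restriction_monoid_axioms g t(1)])
    also have "\<dots> = eval (trivial_restr M) (\<lambda>u. id (word_ext M f u)) t"
      by (rule eval_cong [OF _ t(1)]) (use w in simp)
    also have "\<dots> = identity_value M (trivial_restr M) id f p"
      unfolding identity_value_def t(2) by (rule FR_lift_class [OF T g' t(1), symmetric])
    finally show ?thesis .
  qed
  have idmor: "id \<in> monoid_mor M (trivial_restr M)"
    by (simp add: monoid_mor_def hom_def)
  have ident: "h (identity_value M F j f p) = h (identity_value M F j f q)"
    if e: "(p, q) \<in> R" and f: "f \<in> X \<rightarrow> carrier M" for p q f
  proof -
    have pq: "(p, q) \<in> identities X" "admissible X (p, q)" using e R adm by auto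
    have "satisfies_identity X M (trivial_restr M) id (p, q)"
      \<comment> \<open>Admissibility is stated for fixed carrier types; this transfers it to the
        type of \<open>M\<close>.\<close>
      by (rule admissible_all_types [OF pq(2,1) M T idmor])
    then show ?thesis
      using pq(1) f value_h by (simp add: satisfies_identity_def identities_def)
  qed
  from rel consider
      "P = j \<one>\<^bsub>M\<^esub>" "Q = \<one>\<^bsub>F\<^esub>"
    | m n where "m \<in> carrier M" "n \<in> carrier M" "P = j m \<otimes>\<^bsub>F\<^esub> j n"
        "Q = j (m \<otimes>\<^bsub>M\<^esub> n) \<otimes>\<^bsub>F\<^esub> (j m \<otimes>\<^bsub>F\<^esub> j n)\<^sup>*\<^bsub>F\<^esub>"
    | p q f where "(p, q) \<in> R" "f \<in> X \<rightarrow> carrier M"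
        "P = identity_value M F j f p" "Q = identity_value M F j f q"
    unfolding FRR_relations_def Let_def F_def j_def by blast
  then have "h P = h Q" by cases (auto intro: ident)
  then show ?thesis by (simp add: h_def)
qed

section \<open>The presented restriction monoid is proper over the monoid\<close>

lemma proper_expansion_FRR:
  fixes M :: "('m, 'z) monoid_scheme"
  assumes M: "monoid M" and R: "R \<subseteq> identities X" and adm: "\<forall>e\<in>R. admissible X e"
  shows "\<exists>\<iota> \<phi>. proper_expansion (FRR X R M) M \<iota> \<phi>"
proof -
  define A where "A = carrier M"
  define T where "T = trivial_restr M"
  define \<rho> where "\<rho> = {(s, t). (FR_class A s, FR_class A t) \<in> FRR_relations X R M}"
  define \<theta> where "\<theta> = rcong A \<rho>"
  define S where "S = FRR X R M"
  define \<iota> where "\<iota> = (\<lambda>m. \<theta> `` {Gen m})"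
  \<comment> \<open>The value of a class is the common value in \<open>T\<close> of its
    representatives; \<open>\<phi>_class\<close> shows that they all agree.\<close>
  define \<phi> where "\<phi> = (\<lambda>P. the_elem (eval T id ` P))"
  interpret M: monoid M by fact
  have S_eq: "S = term_quot A (rcong A \<rho>)"
    by (simp add: S_def FRR_def FR_presented_def A_def \<rho>_def)
  interpret S: restriction_monoid S
    unfolding S_def by (rule restriction_monoid_FRR)
  have T: "restriction_monoid T"
    unfolding T_def by (rule restriction_monoid_trivial_restr [OF M])
  have idT: "id \<in> A \<rightarrow> carrier T" by (simp add: A_def T_def)
  have T_simps [simp]: "carrier T = carrier M" "\<And>x y. x \<otimes>\<^bsub>T\<^esub> y = x \<otimes>\<^bsub>M\<^esub> y" "\<one>\<^bsub>T\<^esub> = \<one>\<^bsub>M\<^esub>"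
    "\<And>x. x\<^sup>*\<^bsub>T\<^esub> = \<one>\<^bsub>M\<^esub>" "\<And>x. x\<^sup>+\<^bsub>T\<^esub> = \<one>\<^bsub>M\<^esub>"
    by (simp_all add: T_def)
  have \<phi>_class: "\<phi> (\<theta> `` {t}) = eval T id t" if t: "t \<in> rterms A" for t
  proof -
    have "eval T id s = eval T id t" if ts: "(t, s) \<in> \<theta>" for s
    proof (rule rcong_sound [OF T idT _ ts [unfolded \<theta>_def], symmetric])
      fix s t assume "(s, t) \<in> \<rho>" and st: "s \<in> rterms A" "t \<in> rterms A"
      then have "(FR_class A s, FR_class A t) \<in> FRR_relations X R M" by (simp add: \<rho>_def)
      from FRR_relations_trivial [OF M R adm this] show "eval T id s = eval T id t"
        using st FR_lift_class [OF T idT] by (simp add: T_def)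
    qed
    moreover have "(t, t) \<in> \<theta>" unfolding \<theta>_def by (rule rcong.refl [OF t])
    ultimately have "eval T id ` (\<theta> `` {t}) = {eval T id t}" by blast
    then show ?thesis by (simp add: \<phi>_def)
  qed
  have eval_M: "eval T id t \<in> carrier M" if "t \<in> rterms A" for t
    using eval_closed [OF T idT that] by simp
  note class_simps = term_quot_simps(1) [of _ A _ \<rho>, folded S_eq \<theta>_def]
    term_quot_simps(2-4) [of _ A One \<rho>, folded S_eq \<theta>_def]
  have class_one: "\<theta> `` {One} = \<one>\<^bsub>S\<^esub>"
    using class_simps(4) [of One] by simp
  have class_carrier [simp]: "\<theta> `` {t} \<in> carrier S" if "t \<in> rterms A" for t
    unfolding S_eq \<theta>_def by (rule term_quot_carrierI [OF that])
  have classE: "\<exists>t. t \<in> rterms A \<and> P = \<theta> `` {t}" if "P \<in> carrier S" for P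
    using that unfolding S_eq \<theta>_def by (blast elim: term_quot_carrierE)
  have class_eqI: "\<theta> `` {s} = \<theta> `` {t}"
    if "(FR_class A s, FR_class A t) \<in> FRR_relations X R M" "s \<in> rterms A" "t \<in> rterms A" for s t
    using that unfolding \<theta>_def by (simp add: rcong_class_eq \<rho>_def rcong.rel)
  have \<iota>_closed [simp]: "\<iota> m \<in> carrier S" if "m \<in> carrier M" for m
    using that by (simp add: \<iota>_def A_def)
  have \<iota>_one: "\<iota> \<one>\<^bsub>M\<^esub> = \<one>\<^bsub>S\<^esub>"
  proof -
    have "(FR_class A (Gen \<one>\<^bsub>M\<^esub>), FR_class A One) \<in> FRR_relations X R M"
      using FR_simps(4) [of One A One]
      by (simp add: FRR_relations_def Let_def A_def FR_gen_def)
    then have "\<theta> `` {Gen \<one>\<^bsub>M\<^esub>} = \<theta> `` {One}"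
      by (rule class_eqI) (simp_all add: A_def)
    then show ?thesis by (simp add: \<iota>_def class_one)
  qed
  have \<iota>_mult: "\<iota> m \<otimes>\<^bsub>S\<^esub> \<iota> n = \<iota> (m \<otimes>\<^bsub>M\<^esub> n) \<otimes>\<^bsub>S\<^esub> (\<iota> m \<otimes>\<^bsub>S\<^esub> \<iota> n)\<^sup>*\<^bsub>S\<^esub>"
    if mn: "m \<in> carrier M" "n \<in> carrier M" for m n
  proof -
    have "(FR_gen A m \<otimes>\<^bsub>FR A\<^esub> FR_gen A n, FR_gen A (m \<otimes>\<^bsub>M\<^esub> n) \<otimes>\<^bsub>FR A\<^esub>
        (FR_gen A m \<otimes>\<^bsub>FR A\<^esub> FR_gen A n)\<^sup>*\<^bsub>FR A\<^esub>) \<in> FRR_relations X R M"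
      unfolding FRR_relations_def Let_def A_def using mn by blast
    then have "(FR_class A (Mul (Gen m) (Gen n)),
        FR_class A (Mul (Gen (m \<otimes>\<^bsub>M\<^esub> n)) (Star (Mul (Gen m) (Gen n))))) \<in> FRR_relations X R M"
      using mn by (simp add: FR_gen_def FR_simps(1) FR_simps(2) [where t = One] A_def)
    then have "\<theta> `` {Mul (Gen m) (Gen n)} =
        \<theta> `` {Mul (Gen (m \<otimes>\<^bsub>M\<^esub> n)) (Star (Mul (Gen m) (Gen n)))}"
      by (rule class_eqI) (use mn in \<open>simp_all add: A_def\<close>)
    moreover have "\<iota> m \<otimes>\<^bsub>S\<^esub> \<iota> n = \<theta> `` {Mul (Gen m) (Gen n)}"
      using mn by (simp add: \<iota>_def class_simps A_def)
    moreover have "\<iota> (m \<otimes>\<^bsub>M\<^esub> n) \<otimes>\<^bsub>S\<^esub> (\<theta> `` {Mul (Gen m) (Gen n)})\<^sup>*\<^bsub>S\<^esub> =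
        \<theta> `` {Mul (Gen (m \<otimes>\<^bsub>M\<^esub> n)) (Star (Mul (Gen m) (Gen n)))}"
      using mn by (simp add: \<iota>_def class_simps A_def)
    ultimately show ?thesis by (simp only:)
  qed
  \<comment> \<open>A projection to the right of a generator may be replaced by the star of the
    whole product, since the additional factor \<open>(\<iota> m)\<^sup>*\<close> is absorbed by
    \<open>\<iota> m\<close>.\<close>
  have star_absorb: "\<iota> m \<otimes>\<^bsub>S\<^esub> x\<^sup>*\<^bsub>S\<^esub> = \<iota> m \<otimes>\<^bsub>S\<^esub> (\<iota> m \<otimes>\<^bsub>S\<^esub> x\<^sup>*\<^bsub>S\<^esub>)\<^sup>*\<^bsub>S\<^esub>"
    if "m \<in> carrier M" "x \<in> carrier S" for m x
    using that by (simp add: S.star_mult_star S.mult_star flip: S.m_assoc)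
  have decomp: "\<theta> `` {t} = \<iota> (eval T id t) \<otimes>\<^bsub>S\<^esub> (\<theta> `` {t})\<^sup>*\<^bsub>S\<^esub>" if "t \<in> rterms A" for t
    using that
  proof (induction t)
    case (Gen m)
    then show ?case
      using S.mult_star [of "\<iota> m"] by (simp add: \<iota>_def A_def)
  next
    case One
    then show ?case using S.mult_star [of "\<one>\<^bsub>S\<^esub>"] by (simp add: \<iota>_one class_one)
  next
    case (Mul s t)
    define x where "x = \<theta> `` {s}"
    define y where "y = \<theta> `` {t}"
    define m where "m = eval T id s"
    define n where "n = eval T id t"
    have [simp]: "x \<in> carrier S" "y \<in> carrier S" "m \<in> carrier M" "n \<in> carrier M"
      using Mul.prems by (simp_all add: x_def y_def m_def n_def eval_M)
    have x: "x = \<iota> m \<otimes>\<^bsub>S\<^esub> x\<^sup>*\<^bsub>S\<^esub>" and y: "y = \<iota> n \<otimes>\<^bsub>S\<^esub> y\<^sup>*\<^bsub>S\<^esub>"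
      using Mul.IH Mul.prems unfolding x_def y_def m_def n_def rterms_simps by blast+
    \<comment> \<open>In \<open>\<iota> m \<otimes> x\<^sup>* \<otimes> \<iota> n \<otimes>
      y\<^sup>*\<close>, moving \<open>x\<^sup>*\<close> past \<open>\<iota> n\<close> yields
      \<open>(x \<otimes> \<iota> n)\<^sup>*\<close>, and the defining relation then contributes
      \<open>(\<iota> m \<otimes> \<iota> n)\<^sup>*\<close>. The projections so collected form
      \<open>p\<close>.\<close>
    define p where "p = (\<iota> m \<otimes>\<^bsub>S\<^esub> \<iota> n)\<^sup>*\<^bsub>S\<^esub> \<otimes>\<^bsub>S\<^esub> ((x \<otimes>\<^bsub>S\<^esub> \<iota> n)\<^sup>*\<^bsub>S\<^esub> \<otimes>\<^bsub>S\<^esub> y\<^sup>*\<^bsub>S\<^esub>)"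
    have [simp]: "p \<in> carrier S" by (simp add: p_def)
    have p: "p\<^sup>*\<^bsub>S\<^esub> = p"
      by (simp add: p_def S.star_mult_star flip: S.m_assoc)
    have "x \<otimes>\<^bsub>S\<^esub> y = \<iota> m \<otimes>\<^bsub>S\<^esub> (x\<^sup>*\<^bsub>S\<^esub> \<otimes>\<^bsub>S\<^esub> \<iota> n) \<otimes>\<^bsub>S\<^esub> y\<^sup>*\<^bsub>S\<^esub>"
      by (subst x, subst y) (simp add: S.m_assoc)
    also have "\<dots> = (\<iota> m \<otimes>\<^bsub>S\<^esub> \<iota> n) \<otimes>\<^bsub>S\<^esub> ((x \<otimes>\<^bsub>S\<^esub> \<iota> n)\<^sup>*\<^bsub>S\<^esub> \<otimes>\<^bsub>S\<^esub> y\<^sup>*\<^bsub>S\<^esub>)"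
      by (simp add: S.star_mult [of x "\<iota> n"] S.m_assoc)
    also have "\<dots> = \<iota> (m \<otimes>\<^bsub>M\<^esub> n) \<otimes>\<^bsub>S\<^esub> p"
      by (subst \<iota>_mult) (simp_all add: S.m_assoc p_def)
    finally have "x \<otimes>\<^bsub>S\<^esub> y = \<iota> (m \<otimes>\<^bsub>M\<^esub> n) \<otimes>\<^bsub>S\<^esub> p\<^sup>*\<^bsub>S\<^esub>"
      by (simp add: p)
    then have "x \<otimes>\<^bsub>S\<^esub> y = \<iota> (m \<otimes>\<^bsub>M\<^esub> n) \<otimes>\<^bsub>S\<^esub> (x \<otimes>\<^bsub>S\<^esub> y)\<^sup>*\<^bsub>S\<^esub>"
      using star_absorb [of "m \<otimes>\<^bsub>M\<^esub> n" p] by simp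
    moreover have "x \<otimes>\<^bsub>S\<^esub> y = \<theta> `` {Mul s t}"
      using Mul.prems by (simp add: x_def y_def class_simps)
    moreover have "eval T id (Mul s t) = m \<otimes>\<^bsub>M\<^esub> n"
      by (simp add: m_def n_def)
    ultimately show ?case by (simp only:)
  next
    case (Star t)
    \<comment> \<open>Projections evaluate to the identity in \<open>T\<close>, so the claim reduces
      to a star being its own star, without use of the induction hypothesis.\<close>
    have "\<theta> `` {Star t} = (\<theta> `` {t})\<^sup>*\<^bsub>S\<^esub>" using Star.prems by (simp add: class_simps)
    with Star.prems show ?case by (simp add: \<iota>_one)
  next
    case (Plus t)
    have "\<theta> `` {Plus t} = (\<theta> `` {t})\<^sup>+\<^bsub>S\<^esub>" using Plus.prems by (simp add: class_simps)
    with Plus.prems show ?case by (simp add: \<iota>_one S.star_plus)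
  qed
  have "proper_expansion S M \<iota> \<phi>"
  proof unfold_locales
    fix s t assume "s \<in> carrier S" "t \<in> carrier S"
    then obtain a b where "a \<in> rterms A" "s = \<theta> `` {a}" "b \<in> rterms A" "t = \<theta> `` {b}"
      by (meson classE)
    then show "\<phi> (s \<otimes>\<^bsub>S\<^esub> t) = \<phi> s \<otimes>\<^bsub>M\<^esub> \<phi> t"
      by (simp add: class_simps \<phi>_class)
  next
    fix s assume "s \<in> carrier S"
    then obtain a where a: "a \<in> rterms A" "s = \<theta> `` {a}" by (meson classE)
    then show "\<phi> s \<in> carrier M" "\<phi> (s\<^sup>*\<^bsub>S\<^esub>) = \<one>\<^bsub>M\<^esub>" "\<phi> (s\<^sup>+\<^bsub>S\<^esub>) = \<one>\<^bsub>M\<^esub>"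
      by (simp_all add: class_simps \<phi>_class eval_M)
    show "s = \<iota> (\<phi> s) \<otimes>\<^bsub>S\<^esub> s\<^sup>*\<^bsub>S\<^esub>"
      using decomp [OF a(1)] a by (simp add: \<phi>_class)
  next
    fix m assume "m \<in> carrier M"
    then show "\<phi> (\<iota> m) = m" by (simp add: \<iota>_def \<phi>_class A_def)
  qed (simp_all, fact \<iota>_mult)
  then show ?thesis unfolding S_def by blast
qed

theorem corollary5p6:
  fixes M :: "('m, 'z) monoid_scheme"
    and X :: "'x set"
    and R :: "('x list rterm set \<times> 'x list rterm set) set"
  assumes "monoid M"
    and "R \<subseteq> identities X"
    and "\<forall>e\<in>R. admissible X e"
  shows "(left_cancellative M \<longleftrightarrow> right_ample (FRR X R M)) \<and>
         (right_cancellative M \<longleftrightarrow> left_ample (FRR X R M)) \<and>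
         (cancellative M \<longleftrightarrow> ample (FRR X R M))"
proof -
  obtain \<iota> \<phi> where "proper_expansion (FRR X R M) M \<iota> \<phi>"
    using proper_expansion_FRR [OF assms] by blast
  then interpret proper_expansion "FRR X R M" M \<iota> \<phi> .
  show ?thesis
    unfolding cancellative_def ample_def
    using right_ample_if_left_cancellative left_ample_if_right_cancellative
      left_cancellative_if_right_ample right_cancellative_if_left_ample by blast
qed

end
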